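(* Fix a positive integer $c$ and let $$GCE_c=\{(N,M,\chi)\mid \chi \text{ can be extended to a } c\text{-coloring of } G_{N,M}\},$$ where $\chi$ is a partial mapping of $G_{N,M}$ to $[c]$. Then $GCE_c\in DTIME(N^2M^2+2^{O(c^6)})$; that is, there is an algorithm that on input $(N,M,\chi)$ decides membership in $GCE_c$ in time $O(N^2M^2+2^{O(c^6)})$.
   Context: For $x\in\mathbb{N}$, $[x]=\{1,\ldots,x\}$, and $G_{N,M}=[N]\times[M]$. A rectangle of $G_{N,M}$ is a subset of the form $\{(a,b),(a+c_1,b),(a+c_1,b+c_2),(a,b+c_2)\}\subseteq G_{N,M}$ with $a,b,c_1,c_2$ positive integers. A total mapping $G_{N,M}\to[c]$ is a $c$-coloring if no rectangle has all four corners of the same color; a partial mapping can be extended to a $c$-coloring if some total mapping extending it is a $c$-coloring. *)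

theory Defs
  imports Main
begin

section \<open>Grid colorings\<close>

definition grid :: "nat \<Rightarrow> nat \<Rightarrow> (nat \<times> nat) set" where
  "grid N M = {1..N} \<times> {1..M}"

definition rectangle :: "nat \<Rightarrow> nat \<Rightarrow> (nat \<times> nat) set \<Rightarrow> bool" where
  "rectangle N M R \<longleftrightarrow> R \<subseteq> grid N M \<and>
     (\<exists>a b c1 c2. a > 0 \<and> b > 0 \<and> c1 > 0 \<and> c2 > 0 \<and>
        R = {(a, b), (a + c1, b), (a + c1, b + c2), (a, b + c2)})"

definition partial_mapping :: "nat \<Rightarrow> nat \<Rightarrow> nat \<Rightarrow> (nat \<times> nat \<rightharpoonup> nat) \<Rightarrow> bool" where
  "partial_mapping c N M \<chi> \<longleftrightarrow> dom \<chi> \<subseteq> grid N M \<and> ran \<chi> \<subseteq> {1..c}"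

definition total_mapping :: "nat \<Rightarrow> nat \<Rightarrow> nat \<Rightarrow> (nat \<times> nat \<rightharpoonup> nat) \<Rightarrow> bool" where
  "total_mapping c N M f \<longleftrightarrow> dom f = grid N M \<and> ran f \<subseteq> {1..c}"

definition coloring :: "nat \<Rightarrow> nat \<Rightarrow> nat \<Rightarrow> (nat \<times> nat \<rightharpoonup> nat) \<Rightarrow> bool" where
  "coloring c N M f \<longleftrightarrow> total_mapping c N M f \<and>
     \<not> (\<exists>R k. rectangle N M R \<and> (\<forall>p\<in>R. f p = Some k))"

definition extendable :: "nat \<Rightarrow> nat \<Rightarrow> nat \<Rightarrow> (nat \<times> nat \<rightharpoonup> nat) \<Rightarrow> bool" where
  "extendable c N M \<chi> \<longleftrightarrow> (\<exists>f. \<chi> \<subseteq>\<^sub>m f \<and> coloring c N M f)"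

type_synonym gce_input = "nat \<times> nat \<times> (nat \<times> nat \<rightharpoonup> nat)"

definition GCE_inputs :: "nat \<Rightarrow> gce_input set" where
  "GCE_inputs c = {(N, M, \<chi>). N \<ge> 1 \<and> M \<ge> 1 \<and> partial_mapping c N M \<chi>}"

definition GCE :: "nat \<Rightarrow> gce_input set" where
  "GCE c = {(N, M, \<chi>) \<in> GCE_inputs c. extendable c N M \<chi>}"


section \<open>Deterministic multitape Turing machines\<close>

text \<open>
  States and tape symbols are initial segments of the natural numbers; symbol 0 is the blank.
  The tapes are infinite in both directions.  The first tape carries the input.
\<close>

datatype move = Left | Stay | Right

record tm =
  tape_count :: nat
  symbol_count :: nat
  state_count :: nat
  start_state :: nat
  accept_state :: nat
  reject_state :: nat
  transition :: "nat \<Rightarrow> nat list \<Rightarrow> nat \<times> (nat \<times> move) list"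

definition wf_tm :: "tm \<Rightarrow> bool" where
  "wf_tm T \<longleftrightarrow>
     tape_count T \<ge> 1 \<and> symbol_count T \<ge> 1 \<and>
     start_state T < state_count T \<and> accept_state T < state_count T \<and>
     reject_state T < state_count T \<and> accept_state T \<noteq> reject_state T \<and>
     (\<forall>q ss. q < state_count T \<and> length ss = tape_count T \<and> set ss \<subseteq> {..<symbol_count T} \<longrightarrow>
        (case transition T q ss of (q', acts) \<Rightarrow>
           q' < state_count T \<and> length acts = tape_count T \<and>
           fst ` set acts \<subseteq> {..<symbol_count T}))"

text \<open>A tape is its contents together with its head position.\<close>

type_synonym tape = "(int \<Rightarrow> nat) \<times> int"
type_synonym config = "nat \<times> tape list"

definition read_tape :: "tape \<Rightarrow> nat" where
  "read_tape tp = fst tp (snd tp)"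

fun move_offset :: "move \<Rightarrow> int" where
  "move_offset Left = -1"
| "move_offset Stay = 0"
| "move_offset Right = 1"

definition act_tape :: "nat \<times> move \<Rightarrow> tape \<Rightarrow> tape" where
  "act_tape a tp = ((fst tp)(snd tp := fst a), snd tp + move_offset (snd a))"

definition step :: "tm \<Rightarrow> config \<Rightarrow> config" where
  "step T cf =
     (if fst cf \<in> {accept_state T, reject_state T} then cf
      else case transition T (fst cf) (map read_tape (snd cf)) of
             (q', acts) \<Rightarrow> (q', map2 act_tape acts (snd cf)))"

definition input_tape :: "nat list \<Rightarrow> tape" where
  "input_tape w = (\<lambda>i. if 0 \<le> i \<and> i < int (length w) then w ! nat i else 0, 0)"

definition initial :: "tm \<Rightarrow> nat list \<Rightarrow> config" where
  "initial T w = (start_state T, input_tape w # replicate (tape_count T - 1) (input_tape []))"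

definition state_after :: "tm \<Rightarrow> nat list \<Rightarrow> nat \<Rightarrow> nat" where
  "state_after T w t = fst ((step T ^^ t) (initial T w))"

text \<open>
  \<open>X\<close> is the set of admissible inputs, \<open>enc\<close> their encoding as words of nonblank symbols, and
  \<open>time\<close> a bound on the number of steps on each individual input.  Halting configurations are
  fixed points of \<^const>\<open>step\<close>, so having halted after exactly \<open>time x\<close> steps is the same as
  having halted within \<open>time x\<close> steps.
\<close>

definition decides_in_time ::
    "tm \<Rightarrow> 'a set \<Rightarrow> ('a \<Rightarrow> nat list) \<Rightarrow> 'a set \<Rightarrow> ('a \<Rightarrow> nat) \<Rightarrow> bool" where
  "decides_in_time T X enc L time \<longleftrightarrow>
     (\<forall>x\<in>X. set (enc x) \<subseteq> {1..<symbol_count T} \<and>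
        state_after T (enc x) (time x) = (if x \<in> L then accept_state T else reject_state T))"

definition time_decidable ::
    "'a set \<Rightarrow> ('a \<Rightarrow> nat list) \<Rightarrow> 'a set \<Rightarrow> ('a \<Rightarrow> nat) \<Rightarrow> bool" where
  "time_decidable X enc L time \<longleftrightarrow> (\<exists>T. wf_tm T \<and> decides_in_time T X enc L time)"


section \<open>Encoding of the inputs\<close>

text \<open>
  An input is written as \<open>N\<close> in unary, \<open>M\<close> in unary, and then the table of the partial mapping row
  by row, each of these items being followed by the symbol 1.  The unary digit is 2, an
  uncolored grid point is 3, and a grid point of color \<open>k\<close> is \<open>3 + k\<close>.
\<close>

definition encode_point :: "(nat \<times> nat \<rightharpoonup> nat) \<Rightarrow> nat \<Rightarrow> nat \<Rightarrow> nat" where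
  "encode_point \<chi> a b = (case \<chi> (a, b) of None \<Rightarrow> 3 | Some k \<Rightarrow> 3 + k)"

definition encode_row :: "nat \<Rightarrow> (nat \<times> nat \<rightharpoonup> nat) \<Rightarrow> nat \<Rightarrow> nat list" where
  "encode_row M \<chi> a = map (encode_point \<chi> a) [1..<Suc M] @ [1]"

definition encode_GCE :: "gce_input \<Rightarrow> nat list" where
  "encode_GCE = (\<lambda>(N, M, \<chi>). replicate N 2 @ [1] @ replicate M 2 @ [1] @
     concat (map (encode_row M \<chi>) [1..<Suc N]))"

lemma replicate_append_inj:
  assumes "x \<noteq> y" "replicate n x @ y # u = replicate m x @ y # v"
  shows "n = m \<and> u = v"
  using assms(2)
proof (induction n arbitrary: m)
  case 0
  then show ?case using assms(1) by (cases m) auto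
next
  case (Suc n)
  then show ?case using assms(1) by (cases m) auto
qed

lemma inj_on_encode_GCE: "inj_on encode_GCE (GCE_inputs c)"
proof (rule inj_onI)
  fix x y assume x: "x \<in> GCE_inputs c" and y: "y \<in> GCE_inputs c"
    and eq: "encode_GCE x = encode_GCE y"
  obtain N M \<chi> where xd: "x = (N, M, \<chi>)" by (cases x) auto
  obtain N' M' \<psi> where yd: "y = (N', M', \<psi>)" by (cases y) auto
  have 1: "N = N' \<and> replicate M 2 @ 1 # concat (map (encode_row M \<chi>) [1..<Suc N])
      = replicate M' 2 @ 1 # concat (map (encode_row M' \<psi>) [1..<Suc N'])"
    using eq unfolding xd yd encode_GCE_def by (intro replicate_append_inj[of 2 1]) auto
  then have 2: "M = M' \<and> concat (map (encode_row M \<chi>) [1..<Suc N])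
      = concat (map (encode_row M' \<psi>) [1..<Suc N'])"
    by (intro replicate_append_inj[of 2 1]) auto
  have rows: "map (encode_row M \<chi>) [1..<Suc N] = map (encode_row M \<psi>) [1..<Suc N]"
    using 1 2 by (intro iffD1[OF concat_eq_concat_iff])
      (auto simp: encode_row_def zip_map1 zip_map2 zip_same_conv_map simp del: upt_Suc)
  have pt: "encode_point \<chi> a b = encode_point \<psi> a b" if "a \<in> {1..N}" "b \<in> {1..M}" for a b
    using rows that by (auto simp: encode_row_def simp del: upt_Suc)
  have "\<chi> p = \<psi> p" for p
  proof (cases "p \<in> grid N M")
    case True
    then obtain a b where p: "p = (a, b)" "a \<in> {1..N}" "b \<in> {1..M}"
      by (auto simp: grid_def)
    have "k \<ge> 1" if "\<chi> p = Some k \<or> \<psi> p = Some k" for k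
      using x y that unfolding xd yd GCE_inputs_def partial_mapping_def
      by (fastforce dest: ranI)
    then show ?thesis
      using pt[OF p(2,3)] unfolding p encode_point_def
      by (fastforce split: option.splits)
  next
    case False
    then have "p \<notin> dom \<chi>" "p \<notin> dom \<psi>"
      using x y 1 2 unfolding xd yd GCE_inputs_def partial_mapping_def by auto
    then show ?thesis by (simp add: domIff)
  qed
  then show "x = y" using 1 2 xd yd by auto
qed

end

theory Submission
  imports Defs "HOL-Library.Countable_Set"
begin

text \<open>
  If \<open>N \<le> c\<close> then every column has at most \<open>c\<close> points, so its uncolored points can be given
  distinct colors that do not occur in it; these take part in no monochromatic rectangle, and hence
  \<open>\<chi>\<close> is extendable iff it has no monochromatic rectangle itself.  The same holds for \<open>M \<le> c\<close>.
  If \<open>N, M > c\<close> then each row contains two equally colored points among its first \<open>c + 1\<close>, so by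
  the pigeonhole principle there is no \<open>c\<close>-coloring at all when \<open>N > c (c + 1)\<^sup>2\<close>, and likewise for
  \<open>M\<close>.  Only finitely many inputs remain.

  For each \<open>c\<close> a machine of its own may be used, so the finitely many inputs can be looked up in its
  transition table.  The search for a monochromatic rectangle in a grid with at most \<open>c\<close> rows is a
  row by row scan in which the second tape stores, in one cell per column, the whole column read so
  far; with at most \<open>c\<close> columns a finite automaton suffices.  All cases take time \<open>O(N M)\<close>.
\<close>

section \<open>Sweep algorithms on Turing machines\<close>

text \<open>
  A sweep algorithm reads the table row by row.  It has a finite control state and one memory cell
  per column: \<open>upd\<close> is applied at each grid point to the control state and the cell of its column,
  \<open>eol\<close> to the control state at the end of each row.
\<close>

primrec row_run :: "('s \<Rightarrow> 'y \<Rightarrow> nat \<Rightarrow> 's \<times> 'y) \<Rightarrow> (nat \<Rightarrow> nat) \<Rightarrow> nat \<Rightarrow>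
    's \<times> (nat \<Rightarrow> 'y) \<Rightarrow> 's \<times> (nat \<Rightarrow> 'y)" where
  "row_run upd e 0 sY = sY"
| "row_run upd e (Suc j) sY =
     (let (s, Y) = row_run upd e j sY; (s', y) = upd s (Y j) (e j) in (s', Y(j := y)))"

primrec grid_run :: "('s \<Rightarrow> 'y \<Rightarrow> nat \<Rightarrow> 's \<times> 'y) \<Rightarrow> ('s \<Rightarrow> 's) \<Rightarrow> (nat \<Rightarrow> nat \<Rightarrow> nat) \<Rightarrow> nat \<Rightarrow> nat \<Rightarrow>
    's \<times> (nat \<Rightarrow> 'y) \<Rightarrow> 's \<times> (nat \<Rightarrow> 'y)" where
  "grid_run upd eol E M 0 sY = sY"
| "grid_run upd eol E M (Suc a) sY =
     (let (s, Y) = row_run upd (E a) M (grid_run upd eol E M a sY) in (eol s, Y))"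

text \<open>The phases of a run: the first two constructors count the unary parameters,
  \<open>Scan\<close> passes through a row with both heads moving in parallel, and
  \<open>Rewind\<close> brings the second head back to column 0.\<close>

datatype 's ctl = CountN nat | CountM nat nat | Scan 's | Rewind 's | Accept | Reject

section \<open>Cells of the input tape\<close>

lemma nth_concat_uniform:
  assumes "\<forall>xs \<in> set xss. length xs = k" "i < length xss" "j < k"
  shows "concat xss ! (i * k + j) = xss ! i ! j"
  using assms
proof (induction xss arbitrary: i)
  case (Cons xs xss)
  then show ?case by (cases i) (auto simp: nth_append)
qed simp

abbreviation point :: "(nat \<times> nat \<rightharpoonup> nat) \<Rightarrow> nat \<Rightarrow> nat \<Rightarrow> nat" where
  "point \<chi> a b \<equiv> encode_point \<chi> (Suc a) (Suc b)"

lemma point_bounds: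
  assumes "partial_mapping c N M \<chi>"
  shows "3 \<le> point \<chi> i j" "point \<chi> i j \<le> 3 + c"
  using assms by (auto simp: encode_point_def partial_mapping_def dest: ranI split: option.split)

lemma length_encode_rows: "length (concat (map (encode_row M \<chi>) [1..<Suc N])) = N * Suc M"
  by (induction N) (auto simp: encode_row_def)

text \<open>The seven facts cover all cells that the first head visits, up to the blank that ends
  the table. Each row takes \<open>Suc M\<close> cells because of its closing symbol 1.\<close>

lemma input_tape_encode:
  fixes N M \<chi>
  defines "t \<equiv> fst (input_tape (encode_GCE (N, M, \<chi>)))"
  shows "i < N \<Longrightarrow> t (int i) = 2"
    and "t (int N) = 1"
    and "i < M \<Longrightarrow> t (int (Suc N + i)) = 2"
    and "t (int (Suc N + M)) = 1"
    and "a < N \<Longrightarrow> b < M \<Longrightarrow> t (int (N + M + 2 + a * Suc M + b)) = point \<chi> a b"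
    and "a < N \<Longrightarrow> t (int (N + M + 2 + a * Suc M + M)) = 1"
    and "t (int (N + M + 2 + N * Suc M)) = 0"
proof -
  let ?w = "encode_GCE (N, M, \<chi>)" and ?rs = "map (encode_row M \<chi>) [1..<Suc N]"
  have w: "?w = (replicate N 2 @ [1] @ replicate M 2 @ [1]) @ concat ?rs"
    by (simp add: encode_GCE_def del: upt_Suc)
  have len: "length ?w = N + M + 2 + N * Suc M"
    unfolding w length_append length_encode_rows by simp
  have t: "t (int i) = (if i < length ?w then ?w ! i else 0)" for i
    by (simp add: t_def input_tape_def)
  have row: "?w ! (N + M + 2 + (a * Suc M + b)) = encode_row M \<chi> (Suc a) ! b"
    if "a < N" "b < Suc M" for a b
  proof -
    have "concat ?rs ! (a * Suc M + b) = ?rs ! a ! b"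
      by (rule nth_concat_uniform) (use that in \<open>auto simp: encode_row_def simp del: upt_Suc\<close>)
    then show ?thesis
      using that by (simp add: w nth_append del: upt_Suc mult_Suc_right)
  qed
  have lt: "a * Suc M + b < N * Suc M" if "a < N" "b < Suc M" for a b
  proof -
    have "a * Suc M + b < Suc a * Suc M" using that by simp
    also have "\<dots> \<le> N * Suc M" using that by (intro mult_right_mono) auto
    finally show ?thesis .
  qed
  show "t (int i) = 2" if "i < N" using that by (simp only: t len) (simp add: w nth_append)
  show "t (int N) = 1" by (simp only: t len) (simp add: w nth_append)
  show "t (int (Suc N + i)) = 2" if "i < M" using that
    by (simp only: t len) (simp add: w nth_append)
  show "t (int (Suc N + M)) = 1" by (simp only: t len) (simp add: w nth_append)
  show "t (int (N + M + 2 + a * Suc M + b)) = point \<chi> a b" if "a < N" "b < M"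
    using row[of a b] lt[of a b] that
    by (simp only: t len add.assoc) (simp add: encode_row_def nth_append del: upt_Suc mult_Suc_right)
  show "t (int (N + M + 2 + a * Suc M + M)) = 1" if "a < N"
    using row[of a M] lt[of a M] that
    by (simp only: t len add.assoc) (simp add: encode_row_def nth_append del: upt_Suc mult_Suc_right)
  show "t (int (N + M + 2 + N * Suc M)) = 0" by (simp only: t len) simp
qed

text \<open>
  The parameters \<open>N\<close> and \<open>M\<close> are only known to the algorithm up to the threshold \<open>cap\<close>.
\<close>

locale sweep =
  fixes c cap :: nat and S :: "'s set" and Y :: "'y set" and init :: "nat \<Rightarrow> nat \<Rightarrow> 's" and y0 :: 'y
    and upd :: "'s \<Rightarrow> 'y \<Rightarrow> nat \<Rightarrow> 's \<times> 'y" and eol :: "'s \<Rightarrow> 's" and acc :: "'s \<Rightarrow> bool"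
  assumes finite_S: "finite S" and finite_Y: "finite Y" and y0: "y0 \<in> Y"
    and init: "n \<le> cap \<Longrightarrow> m \<le> cap \<Longrightarrow> init n m \<in> S"
    and upd: "s \<in> S \<Longrightarrow> y \<in> Y \<Longrightarrow> 3 \<le> x \<Longrightarrow> x \<le> 3 + c \<Longrightarrow> upd s y x \<in> S \<times> Y"
    and eol: "s \<in> S \<Longrightarrow> eol s \<in> S"
begin

section \<open>Construction of the machine\<close>

definition Q :: "'s ctl set" where
  "Q = CountN ` {..cap} \<union> (\<lambda>(n, m). CountM n m) ` ({..cap} \<times> {..cap}) \<union>
     Scan ` S \<union> Rewind ` S \<union> {Accept, Reject}"

lemma finite_Q: "finite Q"
  using finite_S by (auto simp: Q_def)

lemma Q_iff [simp]:
  "CountN n \<in> Q \<longleftrightarrow> n \<le> cap" "CountM n m \<in> Q \<longleftrightarrow> n \<le> cap \<and> m \<le> cap"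
  "Scan s \<in> Q \<longleftrightarrow> s \<in> S" "Rewind s \<in> Q \<longleftrightarrow> s \<in> S" "Accept \<in> Q" "Reject \<in> Q"
  by (auto simp: Q_def)

text \<open>The second tape holds the column cells; a blank stands for the initial content \<open>y0\<close>.  Cells
  are made nonblank when they are visited, so that the head recognizes the left end on its way back.\<close>

definition ysym :: "'y \<Rightarrow> nat" where
  "ysym y = Suc (to_nat_on Y y)"

definition ydec :: "nat \<Rightarrow> 'y" where
  "ydec k = (case k of 0 \<Rightarrow> y0 | Suc i \<Rightarrow> from_nat_into Y i)"

lemma ydec_in: "ydec k \<in> Y"
  using y0 from_nat_into[of Y] by (auto simp: ydec_def split: nat.split)

lemma ydec_0 [simp]: "ydec 0 = y0"
  by (simp add: ydec_def)

lemma ydec_ysym [simp]: "y \<in> Y \<Longrightarrow> ydec (ysym y) = y"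
  using finite_Y by (simp add: ydec_def ysym_def countable_finite)

lemma ysym_pos [simp]: "0 < ysym y"
  by (simp add: ysym_def)

text \<open>Input symbols reach up to \<open>3 + c\<close>, and codes of cell contents up to
  \<open>card Y\<close>, since \<open>ysym\<close> skips the blank.\<close>

definition nsym :: nat where
  "nsym = max (4 + c) (Suc (card Y))"

lemma ysym_less: "y \<in> Y \<Longrightarrow> ysym y < nsym"
  using bij_betw_apply[OF to_nat_on_finite[OF finite_Y]] by (fastforce simp: ysym_def nsym_def)

text \<open>The first head never moves left. The counters saturate at \<open>cap\<close>, which
  keeps the state set finite. At the end of a row the second head stands one cell past the last
  column, so it first steps left; \<open>Rewind\<close> then recognizes the blank cell -1 and steps
  right onto column 0.\<close>

fun delta :: "'s ctl \<Rightarrow> nat \<Rightarrow> nat \<Rightarrow> 's ctl \<times> move \<times> nat \<times> move" where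
  "delta (CountN n) x y =
     (if x = 2 then (CountN (min cap (Suc n)), Right, y, Stay)
      else if x = 1 then (CountM n 0, Right, y, Stay) else (Reject, Stay, y, Stay))"
| "delta (CountM n m) x y =
     (if x = 2 then (CountM n (min cap (Suc m)), Right, y, Stay)
      else if x = 1 then (Scan (init n m), Right, y, Stay) else (Reject, Stay, y, Stay))"
| "delta (Scan s) x y =
     (if x = 0 then (if acc s then Accept else Reject, Stay, y, Stay)
      else if x = 1 then (Rewind (eol s), Right, y, Left)
      else if 3 \<le> x \<and> x \<le> 3 + c
        then (case upd s (ydec y) x of (s', y') \<Rightarrow> (Scan s', Right, ysym y', Right))
      else (Reject, Stay, y, Stay))"
| "delta (Rewind s) x y =
     (if y = 0 then (Scan s, Stay, y, Right) else (Rewind s, Stay, y, Left))"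
| "delta Accept x y = (Accept, Stay, y, Stay)"
| "delta Reject x y = (Reject, Stay, y, Stay)"

lemma delta_closed:
  assumes "q \<in> Q" "y < nsym" "delta q x y = (q', d1, y', d2)"
  shows "q' \<in> Q \<and> y' < nsym"
proof (cases q)
  case (Scan s)
  have "upd s (ydec y) x \<in> S \<times> Y" if "3 \<le> x" "x \<le> 3 + c"
    using upd[OF _ ydec_in] assms(1) that Scan by simp
  then show ?thesis
    using assms Scan eol[of s]
    by (cases "upd s (ydec y) x") (simp split: if_splits; auto simp: ysym_less)
next
  case (CountM n m)
  then show ?thesis using assms init[of n m] by (simp split: if_splits; auto)
next
  case (CountN n)
  then show ?thesis using assms by (simp split: if_splits; auto)
next
  case (Rewind s)
  then show ?thesis using assms by (simp split: if_splits; auto)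
qed (use assms in simp_all)

definition code :: "'s ctl \<Rightarrow> nat" where
  "code = to_nat_on Q"

lemma code_less: "q \<in> Q \<Longrightarrow> code q < card Q"
  using bij_betw_apply[OF to_nat_on_finite[OF finite_Q]] by (auto simp: code_def)

lemma decode_code [simp]: "q \<in> Q \<Longrightarrow> from_nat_into Q (code q) = q"
  using finite_Q by (simp add: code_def countable_finite)

lemma code_eq_iff: "q \<in> Q \<Longrightarrow> q' \<in> Q \<Longrightarrow> code q = code q' \<longleftrightarrow> q = q'"
  by (metis decode_code)

definition machine :: tm where
  "machine = \<lparr>tape_count = 2, symbol_count = nsym, state_count = card Q,
     start_state = code (CountN 0), accept_state = code Accept, reject_state = code Reject,
     transition = \<lambda>q ss. case delta (from_nat_into Q q) (ss ! 0) (ss ! 1) of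
       (q', d1, y', d2) \<Rightarrow> (code q', [(ss ! 0, d1), (y', d2)])\<rparr>"

lemma machine_simps [simp]:
  "tape_count machine = 2" "symbol_count machine = nsym" "state_count machine = card Q"
  "start_state machine = code (CountN 0)" "accept_state machine = code Accept"
  "reject_state machine = code Reject"
  by (simp_all add: machine_def)

lemma wf_machine: "wf_tm machine"
proof -
  have "case transition machine q ss of (q', acts) \<Rightarrow>
      q' < card Q \<and> length acts = 2 \<and> fst ` set acts \<subseteq> {..<nsym}"
    if "q < card Q" "length ss = 2" "set ss \<subseteq> {..<nsym}" for q ss
  proof -
    obtain q' d1 y' d2 where d: "delta (from_nat_into Q q) (ss ! 0) (ss ! 1) = (q', d1, y', d2)"
      by (metis prod_cases4)
    have ss: "ss ! 0 < nsym" "ss ! 1 < nsym"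
      using that(2,3) by (auto simp: subset_iff)
    have "from_nat_into Q q \<in> Q"
      by (rule from_nat_into) (use Q_iff(5) in blast)
    from delta_closed[OF this ss(2) d] show ?thesis
      using d ss by (simp add: machine_def code_less)
  qed
  moreover have "1 \<le> nsym" by (simp add: nsym_def)
  ultimately show ?thesis
    unfolding wf_tm_def by (simp add: code_less code_eq_iff)
qed

section \<open>Runs of the machine, phase by phase\<close>

definition conf :: "'s ctl \<Rightarrow> (int \<Rightarrow> nat) \<Rightarrow> int \<Rightarrow> (int \<Rightarrow> nat) \<Rightarrow> int \<Rightarrow> config" where
  "conf q t p u r = (code q, [(t, p), (u, r)])"

text \<open>The machine writes back the symbol it read on the first tape, so the content
  \<open>t\<close> stays the same throughout.\<close>

lemma step_conf:
  assumes "q \<in> Q" "q \<noteq> Accept" "q \<noteq> Reject" "delta q (t p) (u r) = (q', d1, y', d2)"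
  shows "step machine (conf q t p u r) =
    conf q' t (p + move_offset d1) (u(r := y')) (r + move_offset d2)"
  using assms
  by (simp add: step_def conf_def machine_def code_eq_iff read_tape_def act_tape_def)

lemma step_halted:
  "(step machine ^^ k) (conf Accept t p u r) = conf Accept t p u r"
  "(step machine ^^ k) (conf Reject t p u r) = conf Reject t p u r"
  by (induction k) (auto simp: step_def conf_def machine_def)

lemma run_trans:
  "(step machine ^^ i) x = y \<Longrightarrow> (step machine ^^ j) y = z \<Longrightarrow> (step machine ^^ (i + j)) x = z"
  by (subst add.commute) (simp add: funpow_add)

lemma run_Suc:
  "(step machine ^^ i) x = y \<Longrightarrow> step machine y = z \<Longrightarrow> (step machine ^^ Suc i) x = z"
  by simp

lemma run_CountN:
  assumes "\<And>i. i < k \<Longrightarrow> t (int i) = 2"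
  shows "(step machine ^^ k) (conf (CountN 0) t 0 u 0) = conf (CountN (min cap k)) t (int k) u 0"
  using assms
proof (induction k)
  case (Suc k)
  show ?case
    by (rule run_Suc[OF Suc.IH]) (use Suc.prems in \<open>auto simp: step_conf min_def add.commute\<close>)
qed simp

lemma run_CountM:
  assumes "\<And>i. i < k \<Longrightarrow> t (int (p + i)) = 2" "n \<le> cap"
  shows "(step machine ^^ k) (conf (CountM n 0) t (int p) u 0) =
    conf (CountM n (min cap k)) t (int (p + k)) u 0"
  using assms
proof (induction k)
  case (Suc k)
  show ?case
    by (rule run_Suc[OF Suc.IH]) (use Suc.prems in \<open>auto simp: step_conf min_def algebra_simps\<close>)
qed simp

text \<open>From cell \<open>k - 1\<close> it takes \<open>k\<close> steps to reach the blank cell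
  -1 and one more to return to cell 0.\<close>

lemma run_Rewind:
  assumes "\<And>i. i < k \<Longrightarrow> u (int i) \<noteq> 0" "u (-1) = 0" "s \<in> S"
  shows "(step machine ^^ Suc k) (conf (Rewind s) t p u (int k - 1)) = conf (Scan s) t p u 0"
  using assms
proof (induction k)
  case (Suc k)
  have 1: "(step machine ^^ 1) (conf (Rewind s) t p u (int (Suc k) - 1)) =
      conf (Rewind s) t p u (int k - 1)"
    using Suc.prems(1)[of k] Suc.prems(3) by (simp add: step_conf)
  have "(step machine ^^ (1 + Suc k)) (conf (Rewind s) t p u (int (Suc k) - 1)) =
      conf (Scan s) t p u 0"
    by (rule run_trans[OF 1 Suc.IH]) (use Suc.prems in auto)
  then show ?case by simp
qed (simp add: step_conf fun_upd_idem)

text \<open>Cell -1 remains blank as the left end marker. Contents are compared only after decoding,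
  so that an unvisited blank cell counts as \<open>y0\<close>.\<close>

definition tape_inv :: "(int \<Rightarrow> nat) \<Rightarrow> (nat \<Rightarrow> 'y) \<Rightarrow> bool" where
  "tape_inv u Z \<longleftrightarrow> u (-1) = 0 \<and> (\<forall>j. ydec (u (int j)) = Z j)"

text \<open>Every visited cell receives a symbol \<open>ysym y\<close>, which is positive; that
  these cells are nonblank is recorded because \<open>run_Rewind\<close> relies on it.\<close>

lemma run_Scan:
  assumes "tape_inv u Z" "s \<in> S"
    "\<And>i. i < k \<Longrightarrow> t (int (p + i)) = e i" "\<And>i. i < k \<Longrightarrow> 3 \<le> e i \<and> e i \<le> 3 + c"
    "row_run upd e k (s, Z) = (s', Z')"
  shows "s' \<in> S \<and> (\<exists>u'. (step machine ^^ k) (conf (Scan s) t (int p) u 0) =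
      conf (Scan s') t (int (p + k)) u' (int k) \<and> tape_inv u' Z' \<and> (\<forall>i<k. u' (int i) \<noteq> 0))"
  using assms
proof (induction k arbitrary: s' Z')
  case (Suc k)
  obtain s1 Z1 where r1: "row_run upd e k (s, Z) = (s1, Z1)" by fastforce
  obtain s2 y2 where up: "upd s1 (Z1 k) (e k) = (s2, y2)" by fastforce
  have s': "s' = s2" "Z' = Z1(k := y2)" using Suc.prems(5) r1 up by auto
  obtain u1 where s1: "s1 \<in> S" and u1: "tape_inv u1 Z1" "\<forall>i<k. u1 (int i) \<noteq> 0"
    and run: "(step machine ^^ k) (conf (Scan s) t (int p) u 0) =
      conf (Scan s1) t (int (p + k)) u1 (int k)"
    using Suc.IH[OF Suc.prems(1,2) _ _ r1] Suc.prems(3,4) by auto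
  have y: "ydec (u1 (int k)) = Z1 k" using u1 by (simp add: tape_inv_def)
  have ek: "t (int (p + k)) = e k" "3 \<le> e k" "e k \<le> 3 + c" using Suc.prems(3,4) by auto
  have cl: "s2 \<in> S" "y2 \<in> Y"
    using upd[OF s1 ydec_in[of "u1 (int k)"] ek(2,3)] up y by auto
  let ?u = "u1(int k := ysym y2)"
  have "delta (Scan s1) (t (int (p + k))) (u1 (int k)) = (Scan s2, Right, ysym y2, Right)"
    using ek up y by simp
  then have "step machine (conf (Scan s1) t (int (p + k)) u1 (int k)) =
      conf (Scan s2) t (int (p + Suc k)) ?u (int (Suc k))"
    using s1 by (subst step_conf) (auto simp: algebra_simps fun_upd_idem)
  note run_Suc[OF run this]
  moreover have "tape_inv ?u Z'" using u1 cl by (auto simp: tape_inv_def s')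
  moreover have "\<forall>i<Suc k. ?u (int i) \<noteq> 0" using u1 by auto
  ultimately show ?case using cl s' by blast
qed auto

text \<open>A row costs \<open>M\<close> steps for its points, one for its closing symbol and
  \<open>Suc M\<close> for rewinding, together \<open>2 * M + 2\<close>.\<close>

lemma run_rows:
  fixes t :: "int \<Rightarrow> nat"
  assumes "tape_inv u Z" "s \<in> S"
    "\<And>a b. a < k \<Longrightarrow> b < M \<Longrightarrow> t (int (p + a * Suc M + b)) = E a b"
    "\<And>a. a < k \<Longrightarrow> t (int (p + a * Suc M + M)) = 1"
    "\<And>a b. a < k \<Longrightarrow> b < M \<Longrightarrow> 3 \<le> E a b \<and> E a b \<le> 3 + c"
    "grid_run upd eol E M k (s, Z) = (s', Z')"
  shows "s' \<in> S \<and> (\<exists>u'. (step machine ^^ (k * (2 * M + 2))) (conf (Scan s) t (int p) u 0) =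
      conf (Scan s') t (int (p + k * Suc M)) u' 0 \<and> tape_inv u' Z')"
  using assms
proof (induction k arbitrary: s' Z')
  case (Suc k)
  obtain s1 Z1 where r1: "grid_run upd eol E M k (s, Z) = (s1, Z1)" by fastforce
  obtain s2 Z2 where r2: "row_run upd (E k) M (s1, Z1) = (s2, Z2)" by fastforce
  have s': "s' = eol s2" "Z' = Z2" using Suc.prems(6) r1 r2 by auto
  let ?p = "p + k * Suc M"
  obtain u1 where s1: "s1 \<in> S" and u1: "tape_inv u1 Z1"
    and run1: "(step machine ^^ (k * (2 * M + 2))) (conf (Scan s) t (int p) u 0) =
      conf (Scan s1) t (int ?p) u1 0"
    using Suc.IH[OF Suc.prems(1,2) _ _ _ r1] Suc.prems(3-5) by auto
  obtain u2 where s2: "s2 \<in> S" and u2: "tape_inv u2 Z2" "\<forall>i<M. u2 (int i) \<noteq> 0"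
    and run2: "(step machine ^^ M) (conf (Scan s1) t (int ?p) u1 0) =
      conf (Scan s2) t (int (?p + M)) u2 (int M)"
    using run_Scan[OF u1 s1 _ _ r2, of t ?p] Suc.prems(3,5)[of k] by auto
  have "t (int (?p + M)) = 1" using Suc.prems(4) by simp
  then have "step machine (conf (Scan s2) t (int (?p + M)) u2 (int M)) =
      conf (Rewind (eol s2)) t (int (p + Suc k * Suc M)) u2 (int M - 1)"
    using s2 by (subst step_conf) (auto simp: algebra_simps fun_upd_idem)
  note run3 = run_Suc[OF run2 this]
  have "(step machine ^^ Suc M) (conf (Rewind (eol s2)) t (int (p + Suc k * Suc M)) u2 (int M - 1)) =
      conf (Scan (eol s2)) t (int (p + Suc k * Suc M)) u2 0"
    by (rule run_Rewind) (use u2 s2 eol in \<open>auto simp: tape_inv_def\<close>)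
  note run_trans[OF run1 run_trans[OF run3 this]]
  moreover have "k * (2 * M + 2) + (Suc M + Suc M) = Suc k * (2 * M + 2)" by simp
  ultimately show ?case using s' u2 s2 eol by metis
qed auto

text \<open>Counting takes \<open>Suc N\<close> and \<open>Suc M\<close> steps, separators included,
  and the final blank takes one. Any further steps up to \<open>time\<close> leave the halted
  configuration fixed.\<close>

theorem machine_decides:
  assumes "partial_mapping c N M \<chi>"
    "N + M + 3 + N * (2 * M + 2) \<le> time"
  shows "state_after machine (encode_GCE (N, M, \<chi>)) time =
    (if acc (fst (grid_run upd eol (point \<chi>) M N (init (min cap N) (min cap M), \<lambda>_. y0)))
     then accept_state machine else reject_state machine)"
proof -
  define t where "t = fst (input_tape (encode_GCE (N, M, \<chi>)))"
  note t = input_tape_encode[where N = N and M = M and \<chi> = \<chi>, folded t_def]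
  let ?u = "(\<lambda>_. 0) :: int \<Rightarrow> nat"
  have ini: "initial machine (encode_GCE (N, M, \<chi>)) = conf (CountN 0) t 0 ?u 0"
    by (simp add: initial_def conf_def t_def input_tape_def fun_eq_iff)
  obtain s Z where g: "grid_run upd eol (point \<chi>) M N (init (min cap N) (min cap M), \<lambda>_. y0) = (s, Z)"
    by fastforce
  have pt: "3 \<le> point \<chi> a b \<and> point \<chi> a b \<le> 3 + c" for a b
    using point_bounds[OF assms(1)] by simp
  have "step machine (conf (CountN (min cap N)) t (int N) ?u 0) =
      conf (CountM (min cap N) 0) t (int (Suc N)) ?u 0"
    using t(2) by (subst step_conf) (auto simp: algebra_simps fun_upd_idem)
  note r1 = run_Suc[OF run_CountN[of N t, OF t(1)] this]
  have "step machine (conf (CountM (min cap N) (min cap M)) t (int (Suc N + M)) ?u 0) =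
      conf (Scan (init (min cap N) (min cap M))) t (int (N + M + 2)) ?u 0"
    using t(4) by (subst step_conf) (auto simp: algebra_simps fun_upd_idem)
  note r2 = run_Suc[OF run_CountM[of M t "Suc N", OF t(3) min.cobounded1] this]
  have ti: "tape_inv ?u (\<lambda>_. y0)" by (simp add: tape_inv_def)
  obtain u where s: "s \<in> S" and r3: "(step machine ^^ (N * (2 * M + 2)))
      (conf (Scan (init (min cap N) (min cap M))) t (int (N + M + 2)) ?u 0) =
      conf (Scan s) t (int (N + M + 2 + N * Suc M)) u 0"
    using run_rows[OF ti _ t(5) t(6) pt g] init by auto
  let ?h = "if acc s then Accept else Reject"
  have "step machine (conf (Scan s) t (int (N + M + 2 + N * Suc M)) u 0) =
      conf ?h t (int (N + M + 2 + N * Suc M)) u 0"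
    using s t(7) by (subst step_conf) auto
  note r4 = run_Suc[OF r3 this]
  have r5: "(step machine ^^ k) (conf ?h t (int (N + M + 2 + N * Suc M)) u 0) =
      conf ?h t (int (N + M + 2 + N * Suc M)) u 0" for k
    by (simp add: step_halted)
  have "Suc N + (Suc M + (Suc (N * (2 * M + 2)) + (time - (N + M + 3 + N * (2 * M + 2))))) = time"
    using assms(2) by linarith
  with run_trans[OF r1 run_trans[OF r2 run_trans[OF r4 r5]]]
  have "(step machine ^^ time) (conf (CountN 0) t 0 ?u 0) =
      conf ?h t (int (N + M + 2 + N * Suc M)) u 0"
    by metis
  then show ?thesis
    by (simp add: state_after_def ini g conf_def)
qed

end

section \<open>Extendable partial colorings\<close>

text \<open>Grids are indexed from 0 and filled with the codes of the input encoding, so 3 is an uncolored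
  point and the values above 3 are the colors.\<close>

definition mono_rect :: "(nat \<Rightarrow> nat \<Rightarrow> nat) \<Rightarrow> nat \<Rightarrow> nat \<Rightarrow> bool" where
  "mono_rect E N M \<longleftrightarrow> (\<exists>i i' j j'. i < i' \<and> i' < N \<and> j < j' \<and> j' < M \<and>
     3 < E i j \<and> E i j' = E i j \<and> E i' j = E i j \<and> E i' j' = E i j)"

lemma mono_rectI:
  assumes "i < i'" "i' < N" "j < j'" "j' < M"
    "3 < E i j" "E i j' = E i j" "E i' j = E i j" "E i' j' = E i j"
  shows "mono_rect E N M"
  using assms unfolding mono_rect_def by blast

lemma mono_rect_transpose: "mono_rect (\<lambda>i j. E j i) M N \<longleftrightarrow> mono_rect E N M"
  unfolding mono_rect_def by blast

lemma mono_rect_cong: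
  assumes "\<And>i j. i < N \<Longrightarrow> j < M \<Longrightarrow> E i j = F i j"
  shows "mono_rect E N M \<longleftrightarrow> mono_rect F N M"
proof -
  have "mono_rect F N M" if "mono_rect E N M" "\<And>i j. i < N \<Longrightarrow> j < M \<Longrightarrow> E i j = F i j" for E F
  proof -
    from that(1) obtain i i' j j' where *: "i < i'" "i' < N" "j < j'" "j' < M"
      "3 < E i j" "E i j' = E i j" "E i' j = E i j" "E i' j' = E i j"
      unfolding mono_rect_def by blast
    moreover from * have "i < N" "j < M" by auto
    ultimately show ?thesis
      using that(2)[of i j] that(2)[of i j'] that(2)[of i' j] that(2)[of i' j']
      by (intro mono_rectI[of i i' N j j' M]) auto
  qed
  from this[of E F] this[of F E] show ?thesis using assms by metis
qed

lemma monochromatic_rectangle_iff: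
  assumes "partial_mapping c N M \<chi>"
  shows "(\<exists>R k. rectangle N M R \<and> (\<forall>p\<in>R. \<chi> p = Some k)) \<longleftrightarrow> mono_rect (point \<chi>) N M"
proof
  assume "\<exists>R k. rectangle N M R \<and> (\<forall>p\<in>R. \<chi> p = Some k)"
  then obtain a b c1 c2 k where *: "a > 0" "b > 0" "c1 > 0" "c2 > 0"
    "{(a, b), (a + c1, b), (a + c1, b + c2), (a, b + c2)} \<subseteq> grid N M"
    "\<chi> (a, b) = Some k" "\<chi> (a + c1, b) = Some k" "\<chi> (a + c1, b + c2) = Some k"
    "\<chi> (a, b + c2) = Some k"
    unfolding rectangle_def by auto
  \<comment> \<open>A color 0 would have the same code 3 as an uncolored point.\<close>
  have k: "k > 0" using assms *(6) by (auto simp: partial_mapping_def dest: ranI)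
  obtain i j where "a = Suc i" "b = Suc j" using *(1,2) by (metis gr0_implies_Suc)
  then have "i < i + c1 \<and> i + c1 < N \<and> j < j + c2 \<and> j + c2 < M \<and> 3 < point \<chi> i j \<and>
      point \<chi> i (j + c2) = point \<chi> i j \<and> point \<chi> (i + c1) j = point \<chi> i j \<and>
      point \<chi> (i + c1) (j + c2) = point \<chi> i j"
    using * k by (auto simp: encode_point_def grid_def)
  then show "mono_rect (point \<chi>) N M" unfolding mono_rect_def by blast
next
  assume "mono_rect (point \<chi>) N M"
  then obtain i i' j j' where *: "i < i'" "i' < N" "j < j'" "j' < M"
    "3 < point \<chi> i j" "point \<chi> i j' = point \<chi> i j" "point \<chi> i' j = point \<chi> i j"
    "point \<chi> i' j' = point \<chi> i j"
    unfolding mono_rect_def by blast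
  then obtain k where "\<chi> (Suc i, Suc j) = Some k" "k > 0"
    by (auto simp: encode_point_def split: option.splits)
  then have k: "\<chi> (Suc i, Suc j) = Some k" "\<chi> (Suc i', Suc j) = Some k" "\<chi> (Suc i', Suc j') = Some k"
    "\<chi> (Suc i, Suc j') = Some k"
    using *(5-) by (auto simp: encode_point_def split: option.splits)
  let ?R = "{(Suc i, Suc j), (Suc i + (i' - i), Suc j), (Suc i + (i' - i), Suc j + (j' - j)),
    (Suc i, Suc j + (j' - j))}"
  have "rectangle N M ?R"
  proof -
    have "?R \<subseteq> grid N M" using *(1-4) by (auto simp: grid_def)
    moreover have "0 < Suc i" "0 < Suc j" "0 < i' - i" "0 < j' - j" using *(1,3) by simp_all
    ultimately show ?thesis unfolding rectangle_def by blast
  qed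
  moreover have "\<forall>p\<in>?R. \<chi> p = Some k" using k *(1,3) by auto
  ultimately show "\<exists>R k. rectangle N M R \<and> (\<forall>p\<in>R. \<chi> p = Some k)" by blast
qed

section \<open>Completions of coded grids\<close>

definition completes :: "nat \<Rightarrow> nat \<Rightarrow> nat \<Rightarrow> (nat \<Rightarrow> nat \<Rightarrow> nat) \<Rightarrow> (nat \<Rightarrow> nat \<Rightarrow> nat) \<Rightarrow> bool" where
  "completes c N M E F \<longleftrightarrow>
     (\<forall>i<N. \<forall>j<M. 3 < F i j \<and> F i j \<le> 3 + c \<and> (3 < E i j \<longrightarrow> F i j = E i j))"

lemma extendable_iff:
  assumes \<chi>: "partial_mapping c N M \<chi>"
  shows "extendable c N M \<chi> \<longleftrightarrow> (\<exists>F. completes c N M (point \<chi>) F \<and> \<not> mono_rect F N M)"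
proof
  assume "extendable c N M \<chi>"
  then obtain f where f: "\<chi> \<subseteq>\<^sub>m f" "coloring c N M f" unfolding extendable_def by blast
  then have pf: "partial_mapping c N M f"
    by (auto simp: coloring_def total_mapping_def partial_mapping_def)
  have "completes c N M (point \<chi>) (point f)"
    unfolding completes_def
  proof (intro allI impI)
    fix i j assume "i < N" "j < M"
    then have "(Suc i, Suc j) \<in> dom f"
      using f(2) by (auto simp: coloring_def total_mapping_def grid_def)
    then obtain k where k: "f (Suc i, Suc j) = Some k" by blast
    then have "k \<in> {1..c}"
      using f(2) by (auto simp: coloring_def total_mapping_def dest: ranI)
    moreover have "\<chi> (Suc i, Suc j) = Some k'  \<Longrightarrow> k' = k" for k'
      using f(1) k by (force simp: map_le_def)
    ultimately show "3 < point f i j \<and> point f i j \<le> 3 + c \<and>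
        (3 < point \<chi> i j \<longrightarrow> point f i j = point \<chi> i j)"
      using k by (auto simp: encode_point_def split: option.splits)
  qed
  moreover have "\<not> mono_rect (point f) N M"
    using f(2) monochromatic_rectangle_iff[OF pf] unfolding coloring_def by blast
  ultimately show "\<exists>F. completes c N M (point \<chi>) F \<and> \<not> mono_rect F N M" by blast
next
  assume "\<exists>F. completes c N M (point \<chi>) F \<and> \<not> mono_rect F N M"
  then obtain F where F: "completes c N M (point \<chi>) F" "\<not> mono_rect F N M" by blast
  \<comment> \<open>Inverse of \<open>point\<close>: colors are codes minus 3, and indices are
    shifted by one. On the grid neither subtraction is truncated.\<close>
  define f where "f p = (if p \<in> grid N M then Some (F (fst p - 1) (snd p - 1) - 3) else None)" for p
  have Fb: "3 < F (a - 1) (b - 1) \<and> F (a - 1) (b - 1) \<le> 3 + c" if "(a, b) \<in> grid N M" for a b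
  proof -
    have "a - 1 < N" "b - 1 < M" using that by (auto simp: grid_def)
    then show ?thesis using F(1) unfolding completes_def by blast
  qed
  have tf: "total_mapping c N M f"
  proof -
    have "dom f = grid N M" by (auto simp: f_def dom_def)
    moreover have "k \<in> {1..c}" if "k \<in> ran f" for k
    proof -
      from that obtain a b where "f (a, b) = Some k" by (auto simp: ran_def)
      then have "(a, b) \<in> grid N M" "k = F (a - 1) (b - 1) - 3"
        by (auto simp: f_def split: if_splits)
      moreover have "x - 3 \<in> {1..c}" if "3 < x \<and> x \<le> 3 + c" for x using that by auto
      ultimately show ?thesis using Fb[of a b] by blast
    qed
    ultimately show ?thesis unfolding total_mapping_def by blast
  qed
  then have pf: "partial_mapping c N M f" by (simp add: total_mapping_def partial_mapping_def)
  have "point f i j = F i j" if "i < N" "j < M" for i j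
    using that Fb[of "Suc i" "Suc j"] by (auto simp: encode_point_def f_def grid_def)
  then have "\<not> mono_rect (point f) N M" using F(2) mono_rect_cong[of N M "point f" F] by blast
  then have col: "coloring c N M f"
    using tf monochromatic_rectangle_iff[OF pf] unfolding coloring_def by blast
  have "\<chi> p = f p" if "p \<in> dom \<chi>" for p
  proof -
    from that obtain k where k: "\<chi> p = Some k" by blast
    have p: "p \<in> grid N M" "1 \<le> k"
      using \<chi> k by (auto simp: partial_mapping_def dest: ranI)
    then obtain i j where ij: "p = (Suc i, Suc j)" "i < N" "j < M"
      by (cases p; cases "fst p"; cases "snd p") (auto simp: grid_def)
    then have "F i j = 3 + k" using F(1) k p by (auto simp: completes_def encode_point_def)
    then show ?thesis using k p ij by (simp add: f_def)
  qed
  then have "\<chi> \<subseteq>\<^sub>m f" by (simp add: map_le_def)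
  with col show "extendable c N M \<chi>" unfolding extendable_def by blast
qed

lemma mono_rect_if_large:
  assumes F: "\<And>i j. i < N \<Longrightarrow> j < M \<Longrightarrow> 3 < F i j \<and> F i j \<le> 3 + c"
    and M: "c < M" and N: "c * (c + 1)\<^sup>2 < N"
  shows "mono_rect F N M"
proof -
  have "\<exists>j j'. j < j' \<and> j' \<le> c \<and> F i j = F i j'" if i: "i < N" for i
  proof -
    have "F i ` {..c} \<subseteq> {3<..3 + c}" using F i M by auto
    then have "card (F i ` {..c}) < card {..c}"
      using card_mono[of "{3<..3 + c}" "F i ` {..c}"] by simp
    then obtain j j' where "j \<le> c" "j' \<le> c" "j \<noteq> j'" "F i j = F i j'"
      using pigeonhole[of "F i" "{..c}"] by (auto simp: inj_on_def)
    then show ?thesis by (metis linorder_neqE_nat)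
  qed
  then obtain J J' where J: "J i < J' i" "J' i \<le> c" "F i (J i) = F i (J' i)" if "i < N" for i
    by metis
  \<comment> \<open>Classify each row by a repeated pair of columns and its color. There are
    \<open>(c + 1)\<^sup>2\<close> pairs and \<open>c\<close> colors, hence fewer classes than rows,
    and two rows of the same class span a rectangle.\<close>
  define h where "h i = (J i, J' i, F i (J i))" for i
  have "h i \<in> {..c} \<times> {..c} \<times> {3<..3 + c}" if "i < N" for i
    using J[OF that] F[OF that, of "J i"] M by (auto simp: h_def)
  then have "card (h ` {..<N}) \<le> card ({..c} \<times> {..c} \<times> {3<..3 + c})"
    by (intro card_mono image_subsetI) simp_all
  also have "\<dots> < card {..<N}"
    using N by (simp add: power2_eq_square algebra_simps)
  finally obtain i i' where "i < N" "i' < N" "i \<noteq> i'" "h i = h i'"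
    using pigeonhole[of h "{..<N}"] by (auto simp: inj_on_def)
  then obtain i i' where i: "i < i'" "i' < N" "h i = h i'"
    by (metis linorder_neqE_nat)
  then have "i < N" by simp
  have "J i = J i'" "J' i = J' i'" "F i (J i) = F i' (J i')" using i(3) by (auto simp: h_def)
  then have "i < i' \<and> i' < N \<and> J i < J' i \<and> J' i < M \<and> 3 < F i (J i) \<and> F i (J' i) = F i (J i) \<and>
      F i' (J i) = F i (J i) \<and> F i' (J' i) = F i (J i)"
    using i J[OF \<open>i < N\<close>] J[OF i(2)] F[OF \<open>i < N\<close>, of "J i"] M by auto
  then show ?thesis unfolding mono_rect_def by blast
qed

lemma complete_line:
  fixes e :: "nat \<Rightarrow> nat"
  assumes "n \<le> c" and e: "\<And>i. i < n \<Longrightarrow> 3 \<le> e i \<and> e i \<le> 3 + c"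
  shows "\<exists>g :: nat \<Rightarrow> nat. \<forall>i<n. 3 < g i \<and> g i \<le> 3 + c \<and> (3 < e i \<longrightarrow> g i = e i) \<and>
    (\<forall>i'<n. i \<noteq> i' \<and> g i = g i' \<longrightarrow> 3 < e i \<and> 3 < e i')"
proof -
  define U where "U = {i. i < n \<and> e i = 3}"
  define V where "V = {i. i < n \<and> 3 < e i}"
  have UV: "U \<union> V = {..<n}" "U \<inter> V = {}" using e by (force simp: U_def V_def)+
  have fin: "finite U" "finite V" by (simp_all add: U_def V_def)
  have "card U + card V = n" using UV fin by (metis card_Un_disjoint card_lessThan)
  moreover have "card (e ` V) \<le> card V" using fin by (rule_tac card_image_le)
  moreover have "card ({3<..3 + c} - e ` V) \<ge> c - card (e ` V)"
    using diff_card_le_card_Diff[of "e ` V" "{3<..3 + c}"] fin by simp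
  ultimately have "card U \<le> card ({3<..3 + c} - e ` V)" using assms(1) by linarith
  then obtain h where h: "h ` U \<subseteq> {3<..3 + c} - e ` V" "inj_on h U"
    using card_le_inj[OF fin(1)] by (metis finite_Diff finite_greaterThanAtMost)
  define g where "g i = (if i \<in> U then h i else e i)" for i
  have gU: "g i \<in> {3<..3 + c}" "g i \<notin> e ` V" if "i \<in> U" for i using h(1) that by (auto simp: g_def)
  have gV: "g i = e i" "3 < e i" if "i \<in> V" for i using that UV by (auto simp: g_def V_def)
  have "3 < g i \<and> g i \<le> 3 + c \<and> (3 < e i \<longrightarrow> g i = e i) \<and>
      (\<forall>i'<n. i \<noteq> i' \<and> g i = g i' \<longrightarrow> 3 < e i \<and> 3 < e i')" if i: "i < n" for i
  proof (cases "i \<in> U")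
    case True
    have "g i \<noteq> g i'" if "i' < n" "i \<noteq> i'" for i'
    proof (cases "i' \<in> U")
      case True
      then show ?thesis using h(2) \<open>i \<in> U\<close> that(2) by (auto simp: g_def inj_on_def)
    next
      case False
      then have "i' \<in> V" using UV that by blast
      then show ?thesis using gU(2)[OF \<open>i \<in> U\<close>] gV(1)[of i'] by (metis imageI)
    qed
    then show ?thesis using gU(1)[OF True] True by (auto simp: U_def)
  next
    case False
    then have iV: "i \<in> V" using UV i by blast
    have "3 < e i'" if "i' < n" "g i = g i'" for i'
    proof (cases "i' \<in> U")
      case True
      then show ?thesis using gU(2)[OF True] gV(1)[OF iV] that iV by (metis imageI)
    next
      case False
      then have "i' \<in> V" using UV that by blast
      then show ?thesis by (rule gV)
    qed
    then show ?thesis using gV[OF iV] e[OF i] by auto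
  qed
  then show ?thesis by blast
qed

text \<open>Complete each column separately by \<open>complete_line\<close>. A rectangle of
  \<open>F\<close> repeats its color within both of its columns, so all four corners were already
  colored in \<open>E\<close>.\<close>

lemma completion_if_few_rows:
  assumes "N \<le> c" and E: "\<And>i j. 3 \<le> E i j \<and> E i j \<le> 3 + c" and "\<not> mono_rect E N M"
  shows "\<exists>F. completes c N M E F \<and> \<not> mono_rect F N M"
proof -
  let ?P = "\<lambda>j g. \<forall>i<N. 3 < g i \<and> g i \<le> 3 + c \<and> (3 < E i j \<longrightarrow> g i = E i j) \<and>
      (\<forall>i'<N. i \<noteq> i' \<and> g i = g i' \<longrightarrow> 3 < E i j \<and> 3 < E i' j)"
  have ex: "\<exists>g. ?P j g" for j
    using assms(1) E by (rule complete_line)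
  define G where "G j = (SOME g. ?P j g)" for j
  have G: "?P j (G j)" for j unfolding G_def by (rule someI_ex[OF ex])
  define F where "F i j = G j i" for i j
  have "completes c N M E F" unfolding completes_def F_def using G by blast
  moreover have "\<not> mono_rect F N M"
  proof
    assume "mono_rect F N M"
    then obtain i i' j j' where *: "i < i'" "i' < N" "j < j'" "j' < M"
      "F i j' = F i j" "F i' j = F i j" "F i' j' = F i j"
      unfolding mono_rect_def by blast
    have iN: "i < N" "i \<noteq> i'" using * by auto
    have "3 < E i b \<and> 3 < E i' b \<and> F i b = E i b \<and> F i' b = E i' b" if "F i b = F i' b" for b
      using G[of b] iN *(2) that unfolding F_def by blast
    from this[of j] this[of j'] have "mono_rect E N M"
      using * by (intro mono_rectI[of i i' N j j' M]) auto
    with assms(3) show False ..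
  qed
  ultimately show ?thesis by blast
qed

lemma completes_transpose:
  "completes c M N (\<lambda>i j. E j i) (\<lambda>i j. F j i) \<longleftrightarrow> completes c N M E F"
  by (auto simp: completes_def)

text \<open>A completion keeps every monochromatic rectangle of the given grid. Conversely
  \<open>completion_if_few_rows\<close> applies to the grid or, when only \<open>M\<close> is small,
  to its transpose.\<close>

lemma extendable_iff_few_lines:
  assumes \<chi>: "partial_mapping c N M \<chi>" and "N \<le> c \<or> M \<le> c"
  shows "extendable c N M \<chi> \<longleftrightarrow> \<not> mono_rect (point \<chi>) N M"
proof
  assume "extendable c N M \<chi>"
  then obtain F where F: "completes c N M (point \<chi>) F" "\<not> mono_rect F N M"
    using extendable_iff[OF \<chi>] by blast
  show "\<not> mono_rect (point \<chi>) N M"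
  proof
    assume "mono_rect (point \<chi>) N M"
    then obtain i i' j j' where *: "i < i'" "i' < N" "j < j'" "j' < M"
      "3 < point \<chi> i j" "point \<chi> i j' = point \<chi> i j" "point \<chi> i' j = point \<chi> i j"
      "point \<chi> i' j' = point \<chi> i j"
      unfolding mono_rect_def by blast
    moreover from * have "i < N" "j < M" by auto
    ultimately have "F i j = point \<chi> i j" "F i j' = point \<chi> i j" "F i' j = point \<chi> i j"
      "F i' j' = point \<chi> i j"
      using F(1) by (auto simp: completes_def)
    with * have "mono_rect F N M" by (intro mono_rectI[of i i' N j j' M]) auto
    with F(2) show False ..
  qed
next
  assume nm: "\<not> mono_rect (point \<chi>) N M"
  have E: "3 \<le> point \<chi> i j \<and> point \<chi> i j \<le> 3 + c" for i j using point_bounds[OF \<chi>] by simp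
  have "\<exists>F. completes c N M (point \<chi>) F \<and> \<not> mono_rect F N M"
  proof (cases "N \<le> c")
    case True
    from this E nm show ?thesis by (rule completion_if_few_rows)
  next
    case False
    then have "M \<le> c" using assms(2) by simp
    moreover have "\<not> mono_rect (\<lambda>i j. point \<chi> j i) M N"
      using nm mono_rect_transpose[of "point \<chi>" M N] by blast
    ultimately obtain F where "completes c M N (\<lambda>i j. point \<chi> j i) F" "\<not> mono_rect F M N"
      using completion_if_few_rows[of M c "\<lambda>i j. point \<chi> j i" N] E by auto
    then have "completes c N M (point \<chi>) (\<lambda>i j. F j i)" "\<not> mono_rect (\<lambda>i j. F j i) N M"
      using completes_transpose[of c N M "\<lambda>i j. point \<chi> j i" F] mono_rect_transpose[of F N M]
      by blast+
    then show ?thesis by blast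
  qed
  then show "extendable c N M \<chi>" using extendable_iff[OF \<chi>] by blast
qed

lemma not_extendable_if_large:
  assumes \<chi>: "partial_mapping c N M \<chi>" and "c < N" "c < M"
    and "c * (c + 1)\<^sup>2 < N \<or> c * (c + 1)\<^sup>2 < M"
  shows "\<not> extendable c N M \<chi>"
proof
  assume "extendable c N M \<chi>"
  then obtain F where F: "completes c N M (point \<chi>) F" "\<not> mono_rect F N M"
    using extendable_iff[OF \<chi>] by blast
  then have b: "3 < F i j \<and> F i j \<le> 3 + c" if "i < N" "j < M" for i j
    using that by (auto simp: completes_def)
  have "mono_rect F N M"
  proof (cases "c * (c + 1)\<^sup>2 < N")
    case True
    then show ?thesis using mono_rect_if_large[of N M F c] b assms(3) by blast
  next
    case False
    then have "mono_rect (\<lambda>i j. F j i) M N"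
      using mono_rect_if_large[of M N "\<lambda>i j. F j i" c] b assms(2,4) by blast
    then show ?thesis using mono_rect_transpose[of F M N] by blast
  qed
  with F(2) show False ..
qed

section \<open>Deciding extendability\<close>

text \<open>
  \<open>Few_Rows P\<close>: \<open>(i, k) \<in> P\<close> if the current row and row \<open>i\<close> share the color code \<open>k\<close> in some column
  read so far; the column cells contain the columns.
  \<open>Few_Cols P r\<close>: \<open>(j, j', k) \<in> P\<close> if some earlier row has color code \<open>k\<close> in the columns \<open>j < j'\<close>;
  \<open>r\<close> is the part of the current row already read.
  \<open>Table n m w\<close>: \<open>w\<close> is the part of the table already read.
\<close>

datatype memory = Fail | Few_Rows "(nat \<times> nat) set" | Few_Cols "(nat \<times> nat \<times> nat) set" "nat list"
  | Table nat nat "nat list"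

text \<open>The least side length to which \<open>not_extendable_if_large\<close> applies. It also
  serves as \<open>cap\<close>, so a count equal to it stands for every larger value as
  well.\<close>

definition limit :: "nat \<Rightarrow> nat" where
  "limit c = Suc (c * (c + 1)\<^sup>2)"

text \<open>Hence saturated counts still decide whether \<open>N \<le> c\<close> and whether
  \<open>M \<le> c\<close>.\<close>

lemma less_limit: "c < limit c"
  by (simp add: limit_def power2_eq_square)

text \<open>In the third case both sides exceed \<open>c\<close> and one is at least
  \<open>limit c\<close>, so there is no coloring at all and the answer is fixed before the table is
  read.\<close>

definition start_memory :: "nat \<Rightarrow> nat \<Rightarrow> nat \<Rightarrow> memory" where
  "start_memory c n m =
     (if n \<le> c then Few_Rows {} else if m \<le> c then Few_Cols {} []
      else if n = limit c \<or> m = limit c then Fail else Table n m [])"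

definition row_matches :: "nat list \<Rightarrow> nat \<Rightarrow> (nat \<times> nat) set" where
  "row_matches y x = {(i, k). k = x \<and> i < length y \<and> y ! i = x \<and> 3 < x}"

definition equal_pairs :: "nat list \<Rightarrow> (nat \<times> nat \<times> nat) set" where
  "equal_pairs r = {(j, j', k). j < j' \<and> j' < length r \<and> r ! j = k \<and> r ! j' = k \<and> 3 < k}"

text \<open>With few rows, meeting a pair \<open>(i, k)\<close> again means that row
  \<open>i\<close> and the current row share color \<open>k\<close> in two columns. The truncations
  by \<open>take\<close> make the memory finite; on the inputs sent to each case the words stay
  within these bounds, so nothing is lost.\<close>

fun read_point :: "nat \<Rightarrow> memory \<Rightarrow> nat list \<Rightarrow> nat \<Rightarrow> memory \<times> nat list" where
  "read_point c Fail y x = (Fail, y)"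
| "read_point c (Few_Rows P) y x =
     (if P \<inter> row_matches y x = {} then Few_Rows (P \<union> row_matches y x) else Fail, take c (y @ [x]))"
| "read_point c (Few_Cols P r) y x = (Few_Cols P (take c (r @ [x])), y)"
| "read_point c (Table n m w) y x = (Table n m (take (limit c * Suc (limit c)) (w @ [x])), y)"

text \<open>Row matches concern the current row only and are discarded. With few columns the whole
  row is compared at its end, and in a table the closing symbol 1 is appended so that the stored
  word agrees with the input.\<close>

fun end_row :: "nat \<Rightarrow> memory \<Rightarrow> memory" where
  "end_row c Fail = Fail"
| "end_row c (Few_Rows P) = Few_Rows {}"
| "end_row c (Few_Cols P r) =
     (if P \<inter> equal_pairs r = {} then Few_Cols (P \<union> equal_pairs r) [] else Fail)"
| "end_row c (Table n m w) = Table n m (take (limit c * Suc (limit c)) (w @ [1]))"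

text \<open>The \<open>Table\<close> clause is the lookup: it is evaluated only on the finitely many
  memories, so its answers are part of a finite transition table.\<close>

fun accepting :: "nat \<Rightarrow> memory \<Rightarrow> bool" where
  "accepting c Fail \<longleftrightarrow> False"
| "accepting c (Few_Rows P) \<longleftrightarrow> True"
| "accepting c (Few_Cols P r) \<longleftrightarrow> True"
| "accepting c (Table n m w) \<longleftrightarrow>
     (\<exists>\<chi>. (n, m, \<chi>) \<in> GCE c \<and> w = concat (map (encode_row m \<chi>) [1..<Suc n]))"

section \<open>Finiteness of the memory\<close>

definition words :: "nat \<Rightarrow> nat \<Rightarrow> nat list set" where
  "words c l = {w. set w \<subseteq> {..3 + c} \<and> length w \<le> l}"

lemma finite_words: "finite (words c l)"
  unfolding words_def by (rule finite_lists_length_le) simp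

lemma take_in_words: "w \<in> words c l \<Longrightarrow> x \<le> 3 + c \<Longrightarrow> take l (w @ [x]) \<in> words c l"
  by (force simp: words_def dest: in_set_takeD)

definition memories :: "nat \<Rightarrow> memory set" where
  "memories c = {Fail} \<union> Few_Rows ` Pow ({..<c} \<times> {..3 + c}) \<union>
     (\<lambda>(P, r). Few_Cols P r) ` (Pow ({..<c} \<times> {..<c} \<times> {..3 + c}) \<times> words c c) \<union>
     (\<lambda>(n, m, w). Table n m w) `
       ({..limit c} \<times> {..limit c} \<times> words c (limit c * Suc (limit c)))"

lemma memories_iff [simp]:
  "Fail \<in> memories c"
  "Few_Rows P \<in> memories c \<longleftrightarrow> P \<subseteq> {..<c} \<times> {..3 + c}"
  "Few_Cols Q r \<in> memories c \<longleftrightarrow> Q \<subseteq> {..<c} \<times> {..<c} \<times> {..3 + c} \<and> r \<in> words c c"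
  "Table n m w \<in> memories c \<longleftrightarrow> n \<le> limit c \<and> m \<le> limit c \<and> w \<in> words c (limit c * Suc (limit c))"
  by (auto simp: memories_def image_iff)

lemma row_matches_subset:
  "y \<in> words c l \<Longrightarrow> row_matches y x \<subseteq> {..<l} \<times> {..3 + c}"
  using nth_mem by (fastforce simp: words_def row_matches_def)

lemma equal_pairs_subset:
  "r \<in> words c l \<Longrightarrow> equal_pairs r \<subseteq> {..<l} \<times> {..<l} \<times> {..3 + c}"
  using nth_mem by (fastforce simp: words_def equal_pairs_def)

lemma sweep_memory:
  "sweep c (limit c) (memories c) (words c c) (start_memory c) [] (read_point c) (end_row c)"
proof
  show "finite (memories c)"
    unfolding memories_def by (intro finite_UnI finite_imageI finite_cartesian_product)
      (simp_all add: finite_words)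
  show "finite (words c c)" by (rule finite_words)
  show "[] \<in> words c c" by (simp add: words_def)
  show "start_memory c n m \<in> memories c" if "n \<le> limit c" "m \<le> limit c" for n m
    using that by (auto simp: start_memory_def words_def)
  show "read_point c s y x \<in> memories c \<times> words c c"
    if "s \<in> memories c" "y \<in> words c c" "3 \<le> x" "x \<le> 3 + c" for s y x
    using that row_matches_subset[of y c c x] by (cases s) (simp_all add: take_in_words del: take_append)
  show "end_row c s \<in> memories c" if "s \<in> memories c" for s
  proof (cases s)
    case (Few_Cols P r)
    then show ?thesis using that equal_pairs_subset[of r c c] by (simp add: words_def)
  qed (use that in \<open>simp_all add: take_in_words del: take_append\<close>)
qed

section \<open>Correctness of the rectangle searches\<close>

lemma row_run_Fail: "row_run (read_point c) e k (Fail, Z) = (Fail, Z)"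
  by (induction k) auto

lemma grid_run_Fail: "grid_run (read_point c) (end_row c) E M k (Fail, Z) = (Fail, Z)"
  by (induction k) (auto simp: row_run_Fail)

text \<open>A rectangle completed by the first \<open>b\<close> points of row \<open>a\<close>. All
  corners are compared with \<open>E a j'\<close>, the one read last, so passing to
  \<open>Suc b\<close> only adds the case \<open>j' = b\<close>.\<close>

definition closing :: "(nat \<Rightarrow> nat \<Rightarrow> nat) \<Rightarrow> nat \<Rightarrow> nat \<Rightarrow> bool" where
  "closing E a b \<longleftrightarrow> (\<exists>i j j'. i < a \<and> j < j' \<and> j' < b \<and>
     3 < E a j' \<and> E i j = E a j' \<and> E i j' = E a j' \<and> E a j = E a j')"

lemma mono_rect_Suc: "mono_rect E (Suc a) M \<longleftrightarrow> mono_rect E a M \<or> closing E a M"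
proof -
  have "3 < E a j' \<and> E i j = E a j' \<and> E i j' = E a j' \<and> E a j = E a j' \<longleftrightarrow>
      3 < E i j \<and> E i j' = E i j \<and> E a j = E i j \<and> E a j' = E i j" for i j j'
    by auto
  then show ?thesis unfolding closing_def mono_rect_def less_Suc_eq by blast
qed

definition column :: "(nat \<Rightarrow> nat \<Rightarrow> nat) \<Rightarrow> nat \<Rightarrow> nat \<Rightarrow> nat list" where
  "column E a j = map (\<lambda>i. E i j) [0..<a]"

text \<open>Point \<open>b\<close> closes a rectangle with row \<open>i\<close> exactly if both rows
  have its color in column \<open>b\<close> and in some earlier column, that is, if a new match is
  already in the set. Cells left of \<open>b\<close> include the current row, the others do not
  yet.\<close>

lemma row_run_Few_Rows:
  assumes "a < c" "\<forall>j<M. Z j = column E a j" "b \<le> M"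
    "row_run (read_point c) (E a) b (Few_Rows {}, Z) = (s, Z')"
  shows "if closing E a b then s = Fail
    else s = Few_Rows {(i, k). i < a \<and> (\<exists>j<b. E i j = k \<and> E a j = k) \<and> 3 < k} \<and>
      (\<forall>j<M. Z' j = (if j < b then column E (Suc a) j else column E a j))"
  using assms(3,4)
proof (induction b arbitrary: s Z')
  case 0
  then show ?case using assms(2) by (auto simp: closing_def)
next
  case (Suc b)
  obtain s1 Z1 where r: "row_run (read_point c) (E a) b (Few_Rows {}, Z) = (s1, Z1)" by fastforce
  note IH = Suc.IH[OF Suc_leD[OF Suc.prems(1)] r]
  obtain y where up: "read_point c s1 (Z1 b) (E a b) = (s, y)" and Z': "Z' = Z1(b := y)"
    using Suc.prems(2) r by (auto split: prod.splits)
  have closing_Suc: "closing E a (Suc b) \<longleftrightarrow> closing E a b \<or>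
      (\<exists>i j. i < a \<and> j < b \<and> 3 < E a b \<and> E i j = E a b \<and> E i b = E a b \<and> E a j = E a b)"
    unfolding closing_def less_Suc_eq by blast
  show ?case
  proof (cases "closing E a b")
    case True
    then show ?thesis using IH up closing_Suc by auto
  next
    case False
    let ?P = "{(i, k). i < a \<and> (\<exists>j<b. E i j = k \<and> E a j = k) \<and> 3 < k}"
    have s1: "s1 = Few_Rows ?P" and Z1: "\<And>j. j < M \<Longrightarrow> Z1 j = (if j < b then column E (Suc a) j else column E a j)"
      using IH False by auto
    have "Z1 b = column E a b" using Z1 Suc.prems(1) by simp
    then have m: "row_matches (Z1 b) (E a b) = {(i, k). k = E a b \<and> i < a \<and> E i b = k \<and> 3 < k}"
      by (auto simp: row_matches_def column_def)
    \<comment> \<open>The extended column has length \<open>Suc a\<close>, at most \<open>c\<close>,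
      so \<open>take c\<close> keeps all of it.\<close>
    have y: "y = column E (Suc a) b"
      using up s1 \<open>Z1 b = column E a b\<close> assms(1) by (auto simp: column_def)
    have "{(i, k). A i \<and> B i k \<and> C k} \<inter> {(i, k). k = x \<and> A i \<and> D i k \<and> C k} = {} \<longleftrightarrow>
        \<not> (\<exists>i. A i \<and> B i x \<and> D i x \<and> C x)" for A B C D and x :: nat
      by auto
    from this[of "\<lambda>i. i < a" "\<lambda>i k. \<exists>j<b. E i j = k \<and> E a j = k" "\<lambda>k. 3 < k" "E a b"
        "\<lambda>i k. E i b = k"]
    have "?P \<inter> row_matches (Z1 b) (E a b) = {} \<longleftrightarrow>
        \<not> (\<exists>i. i < a \<and> (\<exists>j<b. E i j = E a b \<and> E a j = E a b) \<and> E i b = E a b \<and> 3 < E a b)"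
      unfolding m .
    also have "\<dots> \<longleftrightarrow> \<not> closing E a (Suc b)"
      unfolding closing_Suc using False by simp metis
    finally have d: "?P \<inter> row_matches (Z1 b) (E a b) = {} \<longleftrightarrow> \<not> closing E a (Suc b)" .
    have u: "?P \<union> row_matches (Z1 b) (E a b) =
        {(i, k). i < a \<and> (\<exists>j<Suc b. E i j = k \<and> E a j = k) \<and> 3 < k}"
      unfolding m less_Suc_eq by auto
    have s: "s = (if closing E a (Suc b) then Fail
        else Few_Rows {(i, k). i < a \<and> (\<exists>j<Suc b. E i j = k \<and> E a j = k) \<and> 3 < k})"
      using up unfolding s1 read_point.simps d u by (simp split: if_splits)
    show ?thesis using s y Z1 unfolding Z' by auto
  qed
qed

lemma grid_run_Few_Rows:
  assumes "a \<le> c" "grid_run (read_point c) (end_row c) E M a (Few_Rows {}, \<lambda>_. []) = (s, Z)"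
  shows "if mono_rect E a M then s = Fail else s = Few_Rows {} \<and> (\<forall>j<M. Z j = column E a j)"
  using assms
proof (induction a arbitrary: s Z)
  case 0
  then show ?case by (auto simp: mono_rect_def column_def)
next
  case (Suc a)
  obtain s1 Z1 where r1: "grid_run (read_point c) (end_row c) E M a (Few_Rows {}, \<lambda>_. []) = (s1, Z1)"
    by fastforce
  obtain s2 Z2 where r2: "row_run (read_point c) (E a) M (s1, Z1) = (s2, Z2)" by fastforce
  have s: "s = end_row c s2" "Z = Z2" using Suc.prems(2) r1 r2 by auto
  note IH = Suc.IH[OF Suc_leD[OF Suc.prems(1)] r1]
  have mr: "mono_rect E (Suc a) M \<longleftrightarrow> mono_rect E a M \<or> closing E a M"
    by (rule mono_rect_Suc)
  show ?case
  proof (cases "mono_rect E a M")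
    case True
    then show ?thesis using IH r2 s mr by (auto simp: row_run_Fail)
  next
    case False
    then have "s1 = Few_Rows {}" "\<forall>j<M. Z1 j = column E a j" using IH by auto
    then show ?thesis
      using row_run_Few_Rows[of a c M Z1 E M s2 Z2] r2 Suc.prems(1) mr False s
      by (auto split: if_splits)
  qed
qed

lemma row_run_Few_Cols:
  "k \<le> c \<Longrightarrow> row_run (read_point c) e k (Few_Cols P [], Z) = (Few_Cols P (map e [0..<k]), Z)"
  by (induction k) auto

text \<open>The control state alone suffices here: a rectangle is a triple of two columns and a
  color that occurs in an earlier row and again in the current one.\<close>

lemma grid_run_Few_Cols:
  assumes "M \<le> c"
  shows "fst (grid_run (read_point c) (end_row c) E M a (Few_Cols {} [], Z)) =
    (if mono_rect E a M then Fail
     else Few_Cols {(j, j', k). j < j' \<and> j' < M \<and> 3 < k \<and> (\<exists>i<a. E i j = k \<and> E i j' = k)} [])"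
proof (induction a)
  case 0
  then show ?case by (auto simp: mono_rect_def)
next
  case (Suc a)
  obtain s1 Z1 where r1: "grid_run (read_point c) (end_row c) E M a (Few_Cols {} [], Z) = (s1, Z1)"
    by fastforce
  let ?P = "\<lambda>a. {(j, j', k). j < j' \<and> j' < M \<and> 3 < k \<and> (\<exists>i<a. E i j = k \<and> E i j' = k)}"
  show ?case
  proof (cases "mono_rect E a M")
    case True
    then show ?thesis using Suc r1 mono_rect_Suc[of E a M] by (simp add: row_run_Fail)
  next
    case False
    then have s1: "s1 = Few_Cols (?P a) []" using Suc r1 by simp
    have e: "equal_pairs (map (E a) [0..<M]) =
        {(j, j', k). j < j' \<and> j' < M \<and> E a j = k \<and> E a j' = k \<and> 3 < k}"
      by (auto simp: equal_pairs_def)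
    have d: "?P a \<inter> equal_pairs (map (E a) [0..<M]) = {} \<longleftrightarrow> \<not> mono_rect E (Suc a) M"
    proof -
      define A where "A = ?P a \<inter> equal_pairs (map (E a) [0..<M])"
      have A: "(j, j', k) \<in> A \<longleftrightarrow> j < j' \<and> j' < M \<and> 3 < k \<and> (\<exists>i<a. E i j = k \<and> E i j' = k) \<and>
          E a j = k \<and> E a j' = k" for j j' k
        unfolding A_def e by auto
      have "closing E a M" if t: "t \<in> A" for t
      proof -
        obtain j j' k where "t = (j, j', k)" by (cases t)
        then obtain i where "i < a" "E i j = k" "E i j' = k" "j < j'" "j' < M" "E a j = k"
          "E a j' = k" "3 < k"
          using t A by auto
        then show ?thesis
          unfolding closing_def by (intro exI[of _ i] exI[of _ j] exI[of _ j']) simp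
      qed
      moreover have "A \<noteq> {}" if "closing E a M"
      proof -
        from that obtain i j j' where "i < a" "j < j'" "j' < M" "3 < E a j'" "E i j = E a j'"
          "E i j' = E a j'" "E a j = E a j'"
          unfolding closing_def by blast
        then have "(j, j', E a j') \<in> A" unfolding A by auto
        then show ?thesis by blast
      qed
      ultimately have "A = {} \<longleftrightarrow> \<not> closing E a M" by blast
      then show ?thesis unfolding mono_rect_Suc A_def using False by simp
    qed
    have u: "?P a \<union> equal_pairs (map (E a) [0..<M]) = ?P (Suc a)"
      unfolding e less_Suc_eq by auto
    have "fst (grid_run (read_point c) (end_row c) E M (Suc a) (Few_Cols {} [], Z)) =
        end_row c (Few_Cols (?P a) (map (E a) [0..<M]))"
      using r1 assms by (simp add: s1 row_run_Few_Cols)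
    then show ?thesis unfolding end_row.simps d u by simp
  qed
qed

section \<open>Table lookup and choice of the case\<close>

lemma row_run_Table:
  "length w + k \<le> limit c * Suc (limit c) \<Longrightarrow>
   row_run (read_point c) e k (Table n m w, Z) = (Table n m (w @ map e [0..<k]), Z)"
  by (induction k) auto

lemma grid_run_Table:
  assumes "a * Suc M \<le> limit c * Suc (limit c)"
  shows "grid_run (read_point c) (end_row c) (point \<chi>) M a (Table n m [], Z) =
    (Table n m (concat (map (encode_row M \<chi>) [1..<Suc a])), Z)"
  using assms
proof (induction a)
  case (Suc a)
  let ?w = "concat (map (encode_row M \<chi>) [1..<Suc a])"
  have len: "length ?w + Suc M \<le> limit c * Suc (limit c)"
    unfolding length_encode_rows using Suc.prems by simp
  have row: "encode_row M \<chi> (Suc a) = map (point \<chi> a) [0..<M] @ [1]"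
    by (simp add: encode_row_def map_Suc_upt[symmetric] del: upt_Suc)
  have "grid_run (read_point c) (end_row c) (point \<chi>) M a (Table n m [], Z) = (Table n m ?w, Z)"
    using Suc by simp
  then show ?case
    using len row by (simp add: row_run_Table)
qed simp

lemma accepting_iff_extendable:
  assumes \<chi>: "(N, M, \<chi>) \<in> GCE_inputs c"
  shows "accepting c (fst (grid_run (read_point c) (end_row c) (point \<chi>) M N
      (start_memory c (min (limit c) N) (min (limit c) M), \<lambda>_. []))) \<longleftrightarrow> extendable c N M \<chi>"
    (is "accepting c (fst (?run (?s, _))) \<longleftrightarrow> _")
proof -
  have pm: "partial_mapping c N M \<chi>" using \<chi> by (simp add: GCE_inputs_def)
  consider "N \<le> c" | "c < N" "M \<le> c" | "c < N" "c < M" "limit c \<le> N \<or> limit c \<le> M"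
    | "c < N" "c < M" "N < limit c" "M < limit c" by linarith
  then show ?thesis
  proof cases
    case 1
    then have s: "?s = Few_Rows {}" using less_limit[of c] by (simp add: start_memory_def)
    obtain s Z where r: "?run (Few_Rows {}, \<lambda>_. []) = (s, Z)" by fastforce
    show ?thesis
      using grid_run_Few_Rows[OF 1 r] extendable_iff_few_lines[OF pm] 1
      by (simp add: s r split: if_splits)
  next
    case 2
    then have "?s = Few_Cols {} []" using less_limit[of c] by (simp add: start_memory_def)
    then show ?thesis
      using grid_run_Few_Cols[OF 2(2)] extendable_iff_few_lines[OF pm] 2 by simp
  next
    case 3
    then have "?s = Fail" using less_limit[of c] by (auto simp: start_memory_def)
    then show ?thesis
      using not_extendable_if_large[OF pm] 3 by (auto simp: grid_run_Fail limit_def)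
  next
    case 4
    \<comment> \<open>Both sides lie below the cap, so the counts are exact.\<close>
    then have s: "?s = Table N M []" by (simp add: start_memory_def)
    have le: "N * Suc M \<le> limit c * Suc (limit c)" using 4 by (intro mult_mono) auto
    \<comment> \<open>With \<open>N\<close> and \<open>M\<close> fixed, the stored word determines
      the partial mapping, because the encoding is injective on admissible inputs.\<close>
    have "\<psi> = \<chi>" if "(N, M, \<psi>) \<in> GCE c"
      "concat (map (encode_row M \<chi>) [1..<Suc N]) = concat (map (encode_row M \<psi>) [1..<Suc N])" for \<psi>
    proof -
      have "encode_GCE (N, M, \<psi>) = encode_GCE (N, M, \<chi>)"
        using that(2) by (simp add: encode_GCE_def del: upt_Suc)
      then show ?thesis
        using inj_onD[OF inj_on_encode_GCE _ _ \<chi>] that(1) by (fastforce simp: GCE_def)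
    qed
    moreover have "(N, M, \<chi>) \<in> GCE c \<longleftrightarrow> extendable c N M \<chi>" using \<chi> by (simp add: GCE_def)
    ultimately have "accepting c (Table N M (concat (map (encode_row M \<chi>) [1..<Suc N]))) \<longleftrightarrow>
        extendable c N M \<chi>"
      unfolding accepting.simps by blast
    then show ?thesis
      unfolding s grid_run_Table[OF le] by simp
  qed
qed

lemma set_encode_GCE:
  assumes "(N, M, \<chi>) \<in> GCE_inputs c"
  shows "set (encode_GCE (N, M, \<chi>)) \<subseteq> {1..<4 + c}"
proof -
  have "k \<le> c" if "\<chi> p = Some k" for p k
    using assms that by (auto simp: GCE_inputs_def partial_mapping_def dest: ranI)
  then have "encode_point \<chi> a b \<in> {1..<4 + c}" for a b
    by (auto simp: encode_point_def less_Suc_eq_le split: option.split)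
  then show ?thesis
    using assms by (auto simp: encode_GCE_def encode_row_def GCE_inputs_def simp del: upt_Suc)
qed

text \<open>Each of \<open>1\<close>, \<open>N\<close>, \<open>M\<close> and \<open>N * M\<close> is
  at most \<open>N\<^sup>2 * M\<^sup>2\<close>, and the coefficients 3, 3, 1 and 2 add up to
  9.\<close>

lemma running_time:
  assumes "1 \<le> N" "1 \<le> (M :: nat)"
  shows "N + M + 3 + N * (2 * M + 2) \<le> 9 * (N\<^sup>2 * M\<^sup>2)"
proof -
  have "N * 1 \<le> N * M" "1 * M \<le> N * M" "1 * 1 \<le> N * M" using assms by (intro mult_mono; simp)+
  moreover have "N * M * 1 \<le> N * M * (N * M)" using assms by (intro mult_mono) auto
  moreover have "N * (2 * M + 2) = 2 * (N * M) + 2 * N" by (simp add: algebra_simps)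
  moreover have "N\<^sup>2 * M\<^sup>2 = N * M * (N * M)" by (simp add: power2_eq_square)
  ultimately show ?thesis by linarith
qed

theorem theorem4p5:
  "\<exists>C D :: nat. \<forall>c \<ge> 1.
     time_decidable (GCE_inputs c) encode_GCE (GCE c)
       (\<lambda>(N, M, \<chi>). C * (N\<^sup>2 * M\<^sup>2 + 2 ^ (D * c ^ 6)))"
proof (rule exI[of _ 9], rule exI[of _ 0], intro allI impI)
  \<comment> \<open>With \<open>D = 0\<close> the second summand is just 1: the dependence on
    \<open>c\<close> sits in the size of the machine, not in its number of steps.\<close>
  fix c :: nat
  interpret sweep c "limit c" "memories c" "words c c" "start_memory c" "[]"
    "read_point c" "end_row c" "accepting c"
    by (rule sweep_memory)
  have "decides_in_time machine (GCE_inputs c) encode_GCE (GCE c)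
      (\<lambda>(N, M, \<chi>). 9 * (N\<^sup>2 * M\<^sup>2 + 2 ^ (0 * c ^ 6)))"
    unfolding decides_in_time_def
  proof
    fix x assume x: "x \<in> GCE_inputs c"
    obtain N M \<chi> where x_eq: "x = (N, M, \<chi>)" by (cases x)
    have pm: "partial_mapping c N M \<chi>" and pos: "1 \<le> N" "1 \<le> M"
      using x by (auto simp: x_eq GCE_inputs_def)
    have "set (encode_GCE x) \<subseteq> {1..<symbol_count machine}"
      using set_encode_GCE[OF x[unfolded x_eq]] by (fastforce simp: x_eq nsym_def)
    moreover have "N + M + 3 + N * (2 * M + 2) \<le> 9 * (N\<^sup>2 * M\<^sup>2 + 2 ^ (0 * c ^ 6))"
      using running_time[OF pos] by simp
    note machine_decides[OF pm this]
    moreover have "extendable c N M \<chi> \<longleftrightarrow> x \<in> GCE c" using x by (simp add: x_eq GCE_def)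
    ultimately show "set (encode_GCE x) \<subseteq> {1..<symbol_count machine} \<and>
        state_after machine (encode_GCE x) (case x of (N, M, \<chi>) \<Rightarrow> 9 * (N\<^sup>2 * M\<^sup>2 + 2 ^ (0 * c ^ 6))) =
        (if x \<in> GCE c then accept_state machine else reject_state machine)"
      using accepting_iff_extendable[OF x[unfolded x_eq]] by (simp add: x_eq)
  qed
  then show "time_decidable (GCE_inputs c) encode_GCE (GCE c)
      (\<lambda>(N, M, \<chi>). 9 * (N\<^sup>2 * M\<^sup>2 + 2 ^ (0 * c ^ 6)))"
    unfolding time_decidable_def using wf_machine by blast
qed

end
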